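(* Let $\mathcal{R}$ be a $\ast$-ring, let $a\in\mathcal{R}$ and let $n\geq 2$ be an integer. Then the following statements are equivalent: (i) $a$ is right core invertible; (ii) there exists a unique projection $p\in\mathcal{R}$ such that $pa=0$ and $u=p+a^{n}$ is right invertible in $\mathcal{R}$; (iii) there exists a unique projection $p\in\mathcal{R}$ such that $pa=0$ and $w=a^{n}(1-p)+p$ is right invertible in $\mathcal{R}$.
   Context: A $\ast$-ring is an associative ring $\mathcal{R}$ with identity $1$ equipped with an involution, i.e. a map $\ast:\mathcal{R}\to\mathcal{R}$ with $(a^\ast)^\ast=a$, $(a+b)^\ast=a^\ast+b^\ast$, $(ab)^\ast=b^\ast a^\ast$ for all $a,b\in\mathcal{R}$. A projection is an element $p$ with $p^2=p=p^\ast$. An element $u$ is right invertible if there is $v\in\mathcal{R}$ with $uv=1$. An element $a\in\mathcal{R}$ is right core invertible if $a^\ast\in a^\ast a^2\mathcal{R}$, equivalently if there exists $x\in a\mathcal{R}$ with $a^\ast a x=a^\ast$; any such $x$ is called a right core inverse of $a$ (not necessarily unique). *)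

theory Defs
  imports Main
begin

(* Built on ring + monoid_mult instead of ring_1, since ring_1 assumes 0 \<noteq> 1
   and would exclude the zero ring. *)
class star_ring = ring + monoid_mult +
  fixes star :: "'a \<Rightarrow> 'a"  ("_\<^sup>\<star>" [1000] 999)
  assumes star_star [simp]: "(a\<^sup>\<star>)\<^sup>\<star> = a"
    and star_add: "(a + b)\<^sup>\<star> = a\<^sup>\<star> + b\<^sup>\<star>"
    and star_mult: "(a * b)\<^sup>\<star> = b\<^sup>\<star> * a\<^sup>\<star>"

definition projection :: "'a::star_ring \<Rightarrow> bool"
  where "projection p \<longleftrightarrow> p\<^sup>2 = p \<and> p = p\<^sup>\<star>"

definition right_invertible :: "'a::monoid_mult \<Rightarrow> bool"
  where "right_invertible u \<longleftrightarrow> (\<exists>v. u * v = 1)"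

definition right_core_invertible :: "'a::star_ring \<Rightarrow> bool"
  where "right_core_invertible a \<longleftrightarrow> a\<^sup>\<star> \<in> range (\<lambda>r. a\<^sup>\<star> * a\<^sup>2 * r)"

definition right_core_inverse :: "'a::star_ring \<Rightarrow> 'a \<Rightarrow> bool"
  where "right_core_inverse a x \<longleftrightarrow> x \<in> range (\<lambda>r. a * r) \<and> a\<^sup>\<star> * a * x = a\<^sup>\<star>"

lemma right_core_invertible_iff:
  "right_core_invertible a \<longleftrightarrow> (\<exists>x. right_core_inverse a x)"
  unfolding right_core_invertible_def right_core_inverse_def
  by (auto simp: image_iff power2_eq_square mult.assoc eq_commute)

end

theory Submission
  imports Defs
begin

text \<open>
  If \<open>x\<close> is a right core inverse of \<open>a\<close>, then \<open>a * x\<close> is a projection generating the right ideal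
  \<open>a\<R> = a\<^sup>2\<R> = a\<^sup>3\<R> = \<dots>\<close>, and \<open>p = 1 - a * x\<close> is the required projection. Conversely, if \<open>p * a = 0\<close>
  and \<open>p + a ^ n\<close> or \<open>a ^ n * (1 - p) + p\<close> has a right inverse \<open>v\<close>, then multiplying by \<open>p\<close> on the
  left gives \<open>p * v = p\<close>, whence \<open>1 - p \<in> a ^ n\<R>\<close>. So both conditions say that \<open>1 - p\<close> is a projection
  generating \<open>a\<R> = a ^ n\<R>\<close>. It is unique, because two projections generating the same right ideal
  coincide.
\<close>

lemma star_zero: "(0::'a::star_ring)\<^sup>\<star> = 0"
  using star_add[of "0::'a" 0] by simp

lemma star_one: "(1::'a::star_ring)\<^sup>\<star> = 1"
  using star_mult[of "(1::'a)\<^sup>\<star>" 1] by simp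

lemma star_diff: "(x - y)\<^sup>\<star> = x\<^sup>\<star> - (y::'a::star_ring)\<^sup>\<star>"
  using star_add[of "x - y" y] by (simp add: eq_diff_eq)

lemma projection_complement:
  fixes p :: "'a::star_ring"
  assumes "projection p"
  shows "projection (1 - p)"
  using assms by (auto simp: projection_def power2_eq_square star_diff star_one algebra_simps)

lemma left_annihilator_power:
  fixes a p :: "'a::star_ring"
  assumes "p * a = 0" and "n \<ge> 1"
  shows "p * a ^ n = 0"
  using assms by (cases n) (auto simp flip: mult.assoc)

text \<open>Each of \<open>p\<close> and \<open>q\<close> kills \<open>a ^ n\<close> from the left,
  hence also the complement of the other, so \<open>q = q * p\<close> and \<open>p = p * q\<close>.
  The involution turns the second equation into \<open>p = q * p\<close>.\<close>

lemma complement_in_power_range_unique: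
  fixes a p q :: "'a::star_ring"
  assumes "projection p" "p * a = 0" "a ^ n * y = 1 - p"
    and "projection q" "q * a = 0" "a ^ n * z = 1 - q"
    and "n \<ge> 1"
  shows "p = q"
proof -
  have "q * (1 - p) = 0"
    using left_annihilator_power[OF assms(5,7)] by (simp flip: assms(3) mult.assoc)
  then have qp: "q = q * p"
    by (simp add: algebra_simps)
  have "p * (1 - q) = 0"
    using left_annihilator_power[OF assms(2,7)] by (simp flip: assms(6) mult.assoc)
  then have "p = p * q"
    by (simp add: algebra_simps)
  then have "p\<^sup>\<star> = (p * q)\<^sup>\<star>"
    by simp
  then have "p = q * p"
    using assms(1,4) by (simp add: star_mult projection_def)
  with qp show ?thesis
    by simp
qed

text \<open>The star of \<open>p * a = 0\<close> shows that \<open>a\<^sup>\<star>\<close> is fixed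
  by right multiplication with \<open>1 - p = a ^ n * y\<close>, and \<open>n \<ge> 2\<close> lets
  \<open>a\<^sup>2\<close> be split off.\<close>

lemma right_core_invertible_if_complement_in_power_range:
  fixes a p :: "'a::star_ring"
  assumes p: "projection p" "p * a = 0" and y: "a ^ n * y = 1 - p" and n: "n \<ge> 2"
  shows "right_core_invertible a"
proof -
  have "a\<^sup>\<star> * p = (p * a)\<^sup>\<star>"
    using p(1) by (simp add: star_mult projection_def)
  then have "a\<^sup>\<star> * p = 0"
    using p(2) by (simp add: star_zero)
  then have "a\<^sup>\<star> = a\<^sup>\<star> * (a ^ n * y)"
    by (simp add: y right_diff_distrib)
  also have "a ^ n = a\<^sup>2 * a ^ (n - 2)"
    using n by (metis le_add_diff_inverse power_add)
  finally show ?thesis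
    unfolding right_core_invertible_def by (auto simp: mult.assoc)
qed

text \<open>One \<open>p\<close> serves all exponents at once; this is what later allows passing
  from one exponent to the next.\<close>

lemma right_core_invertible_imp_complement_in_power_range:
  fixes a :: "'a::star_ring"
  assumes "right_core_invertible a"
  obtains p where "projection p" "p * a = 0" "\<And>n. \<exists>y. a ^ n * y = 1 - p"
proof -
  from assms obtain x where "right_core_inverse a x"
    by (auto simp: right_core_invertible_iff)
  then obtain r where x: "x = a * r" and ax: "a\<^sup>\<star> * a * x = a\<^sup>\<star>"
    by (auto simp: right_core_inverse_def)
  define e where "e = a * x"
  have "(a\<^sup>\<star> * e)\<^sup>\<star> = (a\<^sup>\<star>)\<^sup>\<star>"
    using ax by (simp add: e_def mult.assoc)
  then have ea': "e\<^sup>\<star> * a = a"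
    by (simp add: star_mult)
  then have e_star_e: "e\<^sup>\<star> * e = e"
    by (simp add: e_def flip: mult.assoc)
  \<comment> \<open>The product \<open>e\<^sup>\<star> * e\<close> is always self-adjoint, and here
    it equals \<open>e\<close>.\<close>
  then have e_star: "e\<^sup>\<star> = e"
    by (metis star_mult star_star)
  with e_star_e have e: "projection e"
    by (simp add: projection_def power2_eq_square)
  have ea: "e * a = a"
    using ea' e_star by simp
  have e_sq: "a * a * r = e"
    by (simp add: e_def x mult.assoc)
  have "\<exists>y. a ^ n * y = e" for n
  proof -
    \<comment> \<open>The middle factor \<open>a * a * r * a = e * a = a\<close> collapses, so each
      step removes one \<open>a\<close> and one \<open>r * a\<close>.\<close>
    have "a ^ Suc m * (r * a) ^ m * x = e" for m
    proof (induction m)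
      case 0
      show ?case by (simp add: e_def)
    next
      case (Suc m)
      have "a ^ Suc (Suc m) * (r * a) ^ Suc m = a ^ m * (a * a * r * a) * (r * a) ^ m"
        by (simp only: power_Suc2[of a] power_Suc[of "r * a"] mult.assoc)
      also have "\<dots> = a ^ Suc m * (r * a) ^ m"
        by (simp add: e_sq ea power_commutes)
      finally show ?case
        using Suc by simp
    qed
    \<comment> \<open>The surplus factor \<open>a\<close> of \<open>a ^ Suc n\<close> moves into the
      witness, which also covers \<open>n = 0\<close>.\<close>
    then have "a ^ n * (a * (r * a) ^ n * x) = e"
      by (metis mult.assoc power_Suc2)
    then show ?thesis
      by blast
  qed
  then show thesis
    using that[of "1 - e"] projection_complement[OF e] ea by (simp add: left_diff_distrib)
qed

text \<open>By uniqueness at exponent \<open>n\<close>, \<open>p\<close> is the projection that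
  serves all exponents. The extra power provides a witness at exponent \<open>n\<close> of the form
  \<open>a * z\<close>, which \<open>p\<close> annihilates.\<close>

lemma complement_in_power_range_Suc:
  fixes a p :: "'a::star_ring"
  assumes "projection p" "p * a = 0" "a ^ n * y = 1 - p" "n \<ge> 2"
  shows "\<exists>z. a ^ Suc n * z = 1 - p"
proof -
  from assms have "right_core_invertible a"
    by (rule right_core_invertible_if_complement_in_power_range)
  then obtain q where q: "projection q" "q * a = 0" "\<And>m. \<exists>y. a ^ m * y = 1 - q"
    by (rule right_core_invertible_imp_complement_in_power_range) blast
  obtain z where "a ^ n * z = 1 - q"
    using q(3) by blast
  then have "p = q"
    using complement_in_power_range_unique assms q(1,2) by (metis one_le_numeral order_trans)
  then show ?thesis
    using q(3) by blast
qed

lemma right_invertible_add_power_iff: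
  fixes a p :: "'a::star_ring"
  assumes "projection p" "p * a = 0" "n \<ge> 2"
  shows "right_invertible (p + a ^ n) \<longleftrightarrow> (\<exists>y. a ^ n * y = 1 - p)"
proof
  have pp: "p * p = p" and pan: "p * a ^ n = 0"
    using assms left_annihilator_power[of p a n] by (auto simp: projection_def power2_eq_square)
  {
    assume "right_invertible (p + a ^ n)"
    then obtain v where v: "(p + a ^ n) * v = 1"
      by (auto simp: right_invertible_def)
    then have "p * ((p + a ^ n) * v) = p"
      by simp
    then have "p * v = p"
      by (simp add: pp pan distrib_left flip: mult.assoc)
    then have "a ^ n * v = 1 - p"
      using v by (simp add: distrib_right eq_diff_eq add.commute)
    then show "\<exists>y. a ^ n * y = 1 - p" ..
  }
  assume "\<exists>y. a ^ n * y = 1 - p"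
  then obtain z where z: "a ^ Suc n * z = 1 - p"
    using complement_in_power_range_Suc assms by blast
  \<comment> \<open>Taking \<open>v\<close> in the right ideal of \<open>a\<close> forces
    \<open>p * v = 0\<close>, so the summand \<open>p\<close> does not disturb
    \<open>a ^ n * v\<close>.\<close>
  define v where "v = a * z"
  have av: "a ^ n * v = 1 - p"
    using z by (metis mult.assoc power_Suc2 v_def)
  have pv: "p * v = 0"
    using assms(2) by (simp add: v_def flip: mult.assoc)
  have uv: "(p + a ^ n) * v = 1 - p"
    by (simp add: distrib_right av pv)
  \<comment> \<open>The term \<open>v * a ^ n * p\<close> cancels \<open>a ^ n * p = (1 - p) * a ^ n * p\<close>.\<close>
  have "(p + a ^ n) * (v + p - v * a ^ n * p) = 1"
    using uv by (simp add: right_diff_distrib distrib_left flip: mult.assoc)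
      (simp add: algebra_simps pp pan flip: mult.assoc)
  then show "right_invertible (p + a ^ n)"
    by (auto simp: right_invertible_def)
qed

lemma right_invertible_power_mult_complement_iff:
  fixes a p :: "'a::star_ring"
  assumes "projection p" "p * a = 0" "n \<ge> 2"
  shows "right_invertible (a ^ n * (1 - p) + p) \<longleftrightarrow> (\<exists>y. a ^ n * y = 1 - p)"
proof
  have pp: "p * p = p" and pan: "p * a ^ n = 0"
    using assms left_annihilator_power[of p a n] by (auto simp: projection_def power2_eq_square)
  {
    assume "right_invertible (a ^ n * (1 - p) + p)"
    then obtain v where v: "(a ^ n * (1 - p) + p) * v = 1"
      by (auto simp: right_invertible_def)
    then have "p * ((a ^ n * (1 - p) + p) * v) = p"
      by simp
    then have "p * v = p"
      by (simp add: pp pan distrib_left flip: mult.assoc)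
    then have "a ^ n * ((1 - p) * v) = 1 - p"
      using v by (simp add: distrib_right eq_diff_eq mult.assoc)
    then show "\<exists>y. a ^ n * y = 1 - p" ..
  }
  assume "\<exists>y. a ^ n * y = 1 - p"
  then obtain z where z: "a ^ Suc n * z = 1 - p"
    using complement_in_power_range_Suc assms by blast
  define v where "v = a * z"
  have av: "a ^ n * v = 1 - p"
    using z by (metis mult.assoc power_Suc2 v_def)
  have pv: "p * v = 0"
    using assms(2) by (simp add: v_def flip: mult.assoc)
  \<comment> \<open>Here \<open>(1 - p) * v = v\<close> and \<open>(1 - p) * p = 0\<close>, so no
    cross term \<open>a ^ n * p\<close> arises and \<open>v + p\<close> needs no correction.\<close>
  have "(a ^ n * (1 - p) + p) * (v + p) = 1"
    by (simp add: algebra_simps av pv pp)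
  then show "right_invertible (a ^ n * (1 - p) + p)"
    by (auto simp: right_invertible_def)
qed

theorem theorem2p7:
  fixes a :: "'a::star_ring" and n :: nat
  assumes "n \<ge> 2"
  shows "(right_core_invertible a \<longleftrightarrow>
            (\<exists>!p. projection p \<and> p * a = 0 \<and> right_invertible (p + a ^ n)))
       \<and> ((\<exists>!p. projection p \<and> p * a = 0 \<and> right_invertible (p + a ^ n)) \<longleftrightarrow>
            (\<exists>!p. projection p \<and> p * a = 0 \<and> right_invertible (a ^ n * (1 - p) + p)))"
proof -
  \<comment> \<open>For each \<open>p\<close>, the conditions in (ii) and (iii) both amount to
    \<open>P p\<close>; what remains is that right core invertibility means that some
    \<open>p\<close> satisfies \<open>P\<close>, and that there is at most one.\<close>
  define P where "P p \<longleftrightarrow> projection p \<and> p * a = 0 \<and> (\<exists>y. a ^ n * y = 1 - p)" for p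
  have n: "n \<ge> 1"
    using assms by simp
  have u: "projection p \<and> p * a = 0 \<and> right_invertible (p + a ^ n) \<longleftrightarrow> P p" for p
    unfolding P_def
    using right_invertible_add_power_iff[OF _ _ assms] by blast
  have w: "projection p \<and> p * a = 0 \<and> right_invertible (a ^ n * (1 - p) + p) \<longleftrightarrow> P p" for p
    unfolding P_def
    using right_invertible_power_mult_complement_iff[OF _ _ assms] by blast
  have unique: "p = q" if "P p" "P q" for p q
    using that n complement_in_power_range_unique unfolding P_def by blast
  have "right_core_invertible a \<longleftrightarrow> (\<exists>p. P p)"
    unfolding P_def
    using right_core_invertible_imp_complement_in_power_range
      right_core_invertible_if_complement_in_power_range[OF _ _ _ assms]
    by metis
  then have "right_core_invertible a \<longleftrightarrow> (\<exists>!p. P p)"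
    using unique by blast
  then show ?thesis
    unfolding u w by blast
qed

end
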